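(* Let $X,Y$ be Banach spaces, $U$ an open subset of $X$, $f:U\to Y$ a continuous map and $Jf$ a pseudo-Jacobian mapping for $f$ on $U$ satisfying the chain rule condition on $U$. Suppose that $$\alpha:=\inf\{\nu(T) : T\in\mathrm{co}\,Jf(x),\ x\in U\}>0.$$ Then, for each open ball $B(x_0,\delta)\subset U$ we have $$B\bigl(f(x_0),\delta\alpha\bigr)\subset f\bigl(B(x_0,\delta)\bigr).$$ Therefore, the set $V:=f(U)$ is open in $Y$, and $f$ is an open map from $U$ to $V$.
   Context: Banach spaces are real; $\mathcal{L}(X,Y)$ is the space of bounded linear operators from $X$ to $Y$; $B(x,r)$ denotes the open ball; $\mathrm{co}$ denotes convex hull. For $\varphi:U\to\mathbb{R}$ with $U\subset X$ open, $x\in U$ and $v\in X$, $\varphi'_{+}(x;v)=\limsup_{t\to0^+}\frac{\varphi(x+tv)-\varphi(x)}{t}$. For a map $f:U\to Y$ and $x\in U$, a nonempty set $Jf(x)\subset\mathcal{L}(X,Y)$ is a pseudo-Jacobian of $f$ at $x$ if $(y^*\circ f)'_{+}(x;v)\le\sup\{\langle y^*,T(v)\rangle : T\in Jf(x)\}$ for all $y^*\in Y^*$ and $v\in X$. (For real-valued functions, pseudo-Jacobians are subsets of $X^*$.) A set-valued mapping $Jf:U\to2^{\mathcal{L}(X,Y)}$ is a pseudo-Jacobian mapping for $f$ on $U$ if $Jf(x)$ is a pseudo-Jacobian of $f$ at $x$ for every $x\in U$. Chain rule condition: for $y\in Y$ let $d_y(v)=\|v-y\|$, $v\in Y$, and let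 $\partial d_y(v)$ be its Clarke subdifferential (which, $d_y$ being convex and Lipschitz, is the convex subdifferential $\{y^*\in Y^* : \|w-y\|\ge\|v-y\|+\langle y^*,w-v\rangle\ \forall w\in Y\}$). For $x\in U$, $y\in Y$, $y\ne f(x)$, let $A_{x,y}(f)=\{y^*\circ T : y^*\in\partial d_y(f(x)),\ T\in\overline{\mathrm{co}}(Jf(x))\}\subset X^*$, where $\overline{\mathrm{co}}$ is the operator-norm closed convex hull. $Jf$ satisfies the chain rule condition on $U$ if for each $x\in U$ and each $y\in Y$ with $y\neq f(x)$, the set $A_{x,y}(f)$ is a $w^*$-closed and convex pseudo-Jacobian of $d_y\circ f$ at $x$. The co-norm of $T\in\mathcal{L}(X,Y)$ is $\inf_{\|x\|=1}\|Tx\|$, and the surjectivity index is $\nu(T)=\inf_{\|y^*\|=1}\|T^*y^*\|$, the co-norm of the adjoint $T^*:Y^*\to X^*$. *)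

theory Defs
  imports "HOL-Analysis.Analysis"
begin

(* Maps defined on an open set U are total functions of which only the values on U matter:
   for x in U, the point x + t v lies in U for all small t > 0.
   All suprema, infima and upper limits are taken in ereal, so that the possible values
   infinity and -infinity (in particular infima over empty sets) have their usual meaning. *)

definition upper_dini :: "('a::real_normed_vector \<Rightarrow> real) \<Rightarrow> 'a \<Rightarrow> 'a \<Rightarrow> ereal" where
  "upper_dini \<phi> x v = Limsup (at_right 0) (\<lambda>t. ereal ((\<phi> (x + t *\<^sub>R v) - \<phi> x) / t))"

definition pseudo_Jacobian ::
  "('a::real_normed_vector \<Rightarrow> 'b::real_normed_vector) \<Rightarrow> 'a \<Rightarrow> ('a \<Rightarrow>\<^sub>L 'b) set \<Rightarrow> bool" where
  "pseudo_Jacobian f x J \<longleftrightarrow> J \<noteq> {} \<and>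
     (\<forall>(y' :: 'b \<Rightarrow>\<^sub>L real) v.
        upper_dini (\<lambda>u. blinfun_apply y' (f u)) x v
          \<le> (SUP T\<in>J. ereal (blinfun_apply y' (blinfun_apply T v))))"

definition pseudo_Jacobian_mapping ::
  "'a set \<Rightarrow> ('a::real_normed_vector \<Rightarrow> 'b::real_normed_vector) \<Rightarrow> ('a \<Rightarrow> ('a \<Rightarrow>\<^sub>L 'b) set) \<Rightarrow> bool" where
  "pseudo_Jacobian_mapping U f Jf \<longleftrightarrow> (\<forall>x\<in>U. pseudo_Jacobian f x (Jf x))"

(* Intended for locally Lipschitz functions. *)

definition clarke_deriv :: "('a::real_normed_vector \<Rightarrow> real) \<Rightarrow> 'a \<Rightarrow> 'a \<Rightarrow> ereal" where
  "clarke_deriv \<phi> x v =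
     Limsup (nhds x \<times>\<^sub>F at_right 0) (\<lambda>(z, t). ereal ((\<phi> (z + t *\<^sub>R v) - \<phi> z) / t))"

definition clarke_subdifferential ::
  "('a::real_normed_vector \<Rightarrow> real) \<Rightarrow> 'a \<Rightarrow> ('a \<Rightarrow>\<^sub>L real) set" where
  "clarke_subdifferential \<phi> x =
     {x'. \<forall>v. ereal (blinfun_apply x' v) \<le> clarke_deriv \<phi> x v}"

(* For real-valued operators the strong operator topology, i.e. the topology of pointwise
   convergence, is the weak-star topology of the dual space. *)

abbreviation weak_star_topology :: "('a::real_normed_vector \<Rightarrow>\<^sub>L real) topology" where
  "weak_star_topology \<equiv> strong_operator_topology"

definition dist_fun :: "'b::real_normed_vector \<Rightarrow> 'b \<Rightarrow> real" where
  "dist_fun y v = norm (v - y)"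

definition chain_set ::
  "('a::real_normed_vector \<Rightarrow> 'b::real_normed_vector) \<Rightarrow> ('a \<Rightarrow> ('a \<Rightarrow>\<^sub>L 'b) set) \<Rightarrow> 'a \<Rightarrow> 'b
     \<Rightarrow> ('a \<Rightarrow>\<^sub>L real) set" where
  "chain_set f Jf x y =
     {y' o\<^sub>L T | y' T. y' \<in> clarke_subdifferential (dist_fun y) (f x)
                    \<and> T \<in> closure (convex hull (Jf x))}"

definition chain_rule_condition ::
  "'a set \<Rightarrow> ('a::real_normed_vector \<Rightarrow> 'b::real_normed_vector) \<Rightarrow> ('a \<Rightarrow> ('a \<Rightarrow>\<^sub>L 'b) set) \<Rightarrow> bool" where
  "chain_rule_condition U f Jf \<longleftrightarrow>
     (\<forall>x\<in>U. \<forall>y. y \<noteq> f x \<longrightarrow>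
        closedin weak_star_topology (chain_set f Jf x y) \<and>
        convex (chain_set f Jf x y) \<and>
        pseudo_Jacobian (dist_fun y \<circ> f) x (chain_set f Jf x y))"

definition co_norm :: "('a::real_normed_vector \<Rightarrow>\<^sub>L 'b::real_normed_vector) \<Rightarrow> ereal" where
  "co_norm T = (INF x\<in>{x. norm x = 1}. ereal (norm (blinfun_apply T x)))"

lift_definition dual_map ::
  "('a::real_normed_vector \<Rightarrow>\<^sub>L 'b::real_normed_vector) \<Rightarrow> ('b \<Rightarrow>\<^sub>L real) \<Rightarrow>\<^sub>L ('a \<Rightarrow>\<^sub>L real)"
  is "\<lambda>T y'. y' o\<^sub>L T"
  by (rule bounded_bilinear.bounded_linear_left[OF bounded_bilinear_blinfun_compose])

definition surjectivity_index :: "('a::real_normed_vector \<Rightarrow>\<^sub>L 'b::real_normed_vector) \<Rightarrow> ereal" where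
  "surjectivity_index T = co_norm (dual_map T)"

lemma clarke_subdifferential_convex:
  fixes \<phi> :: "'a::real_normed_vector \<Rightarrow> real"
  assumes conv: "convex_on UNIV \<phi>" and cont: "continuous_on UNIV \<phi>"
  shows "clarke_subdifferential \<phi> x = {x'. \<forall>w. \<phi> w \<ge> \<phi> x + blinfun_apply x' (w - x)}"
proof (intro set_eqI iffI; clarsimp simp: clarke_subdifferential_def)
  fix x' w
  assume le: "\<forall>v. ereal (blinfun_apply x' v) \<le> clarke_deriv \<phi> x v"
  define v where "v = w - x"
  have quot: "(\<phi> (z + t *\<^sub>R v) - \<phi> z) / t \<le> \<phi> (z + v) - \<phi> z" if "0 < t" "t < 1" for z t
  proof -
    have "\<phi> ((1 - t) *\<^sub>R z + t *\<^sub>R (z + v)) \<le> (1 - t) * \<phi> z + t * \<phi> (z + v)"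
      using convex_onD[OF conv, of t z "z + v"] that by simp
    moreover have "(1 - t) *\<^sub>R z + t *\<^sub>R (z + v) = z + t *\<^sub>R v"
      by (simp add: algebra_simps)
    ultimately show ?thesis using that by (simp add: field_simps)
  qed
  let ?F = "nhds x \<times>\<^sub>F at_right (0::real)"
  have "\<forall>\<^sub>F t in at_right (0::real). t \<in> {0<..<1}"
    by (rule eventually_at_right_real) simp
  then have ev: "\<forall>\<^sub>F p in ?F. (case p of (z, t) \<Rightarrow> ereal ((\<phi> (z + t *\<^sub>R v) - \<phi> z) / t))
                   \<le> ereal (\<phi> (fst p + v) - \<phi> (fst p))"
    using quot unfolding eventually_prod_filter
    by (intro exI[of _ "\<lambda>_. True"] exI[of _ "\<lambda>t. t \<in> {0<..<1}"]) auto
  have fstlim: "((\<lambda>p. fst p) \<longlongrightarrow> x) ?F"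
    by (rule filterlim_fst)
  have c: "isCont \<phi> u" for u
    using cont by (simp add: continuous_on_eq_continuous_at)
  have "((\<lambda>p. ereal (\<phi> (fst p + v) - \<phi> (fst p))) \<longlongrightarrow> ereal (\<phi> (x + v) - \<phi> x)) ?F"
    by (intro tendsto_intros isCont_tendsto_compose[OF c] fstlim)
  then have "Limsup ?F (\<lambda>p. ereal (\<phi> (fst p + v) - \<phi> (fst p))) = ereal (\<phi> (x + v) - \<phi> x)"
    by (intro lim_imp_Limsup) (simp_all add: prod_filter_eq_bot)
  then have "clarke_deriv \<phi> x v \<le> ereal (\<phi> (x + v) - \<phi> x)"
    using Limsup_mono[OF ev] by (simp add: clarke_deriv_def)
  with le[rule_format, of v] have "ereal (blinfun_apply x' v) \<le> ereal (\<phi> (x + v) - \<phi> x)"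
    by (rule order_trans)
  then show "\<phi> x + blinfun_apply x' (w - x) \<le> \<phi> w"
    by (simp add: v_def)
next
  fix x' v
  assume sub: "\<forall>w. \<phi> x + blinfun_apply x' (w - x) \<le> \<phi> w"
  let ?q = "\<lambda>(z, t). ereal ((\<phi> (z + t *\<^sub>R v) - \<phi> z) / t)"
  have "ereal (blinfun_apply x' v) \<le> ?q (x, t)" if "t > 0" for t
    using sub[rule_format, of "x + t *\<^sub>R v"] that by (simp add: blinfun.bilinear_simps field_simps)
  then have ev: "\<forall>\<^sub>F t in at_right 0. ereal (blinfun_apply x' v) \<le> ?q (x, t)"
    using eventually_at_right_less[of "0::real"] by (auto elim: eventually_mono)
  have fl: "filterlim (\<lambda>t. (x, t)) (nhds x \<times>\<^sub>F at_right 0) (at_right (0::real))"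
    by (intro filterlim_Pair tendsto_const filterlim_ident)
  show "ereal (blinfun_apply x' v) \<le> clarke_deriv \<phi> x v"
    unfolding clarke_deriv_def Limsup_def
  proof (safe intro!: INF_greatest)
    fix P assume "eventually P (nhds x \<times>\<^sub>F at_right (0::real))"
    then have "\<forall>\<^sub>F t in at_right 0. P (x, t)"
      using fl by (rule eventually_compose_filterlim)
    then have "\<forall>\<^sub>F t in at_right (0::real). P (x, t) \<and> ereal (blinfun_apply x' v) \<le> ?q (x, t)"
      using ev by (rule eventually_conj)
    then obtain t where "P (x, t)" "ereal (blinfun_apply x' v) \<le> ?q (x, t)"
      using eventually_happens'[OF trivial_limit_at_right_real] by blast
    then show "ereal (blinfun_apply x' v) \<le> Sup (?q ` Collect P)"
      by (intro SUP_upper2[of "(x, t)"]) auto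
  qed
qed

lemma clarke_subdifferential_dist_fun:
  "clarke_subdifferential (dist_fun y) v =
     {y'. \<forall>w. norm (w - y) \<ge> norm (v - y) + blinfun_apply y' (w - v)}"
proof -
  have "convex_on UNIV (dist_fun y)"
    using convex_on_dist[of UNIV y] unfolding dist_fun_def[abs_def]
    by (simp add: dist_norm norm_minus_commute)
  moreover have "continuous_on UNIV (dist_fun y)"
    unfolding dist_fun_def[abs_def] by (intro continuous_intros)
  ultimately show ?thesis
    by (subst clarke_subdifferential_convex) (auto simp: dist_fun_def)
qed

end

theory Submission
  imports Defs
begin

text \<open>
  Suppose that a point \<open>y\<close> within distance \<open>\<delta> b\<close> of \<open>f x\<^sub>0\<close>, where \<open>b \<le> \<alpha>\<close> is real, were not
  attained on the ball of radius \<open>\<delta>\<close> about \<open>x\<^sub>0\<close>.  Then \<open>\<phi> x = norm (f x - y)\<close> is positive there.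
  As \<open>\<phi> x\<^sub>0 < \<delta> b\<close>, there is a \<open>c < b\<close> for which Ekeland's principle
  (\<open>ekeland_variational_principle\<close>) finds a point \<open>z\<close> of the open ball such that
  \<open>x \<mapsto> \<phi> x + c * dist x z\<close> has a local minimum at \<open>z\<close>.  Hence the upper Dini
  derivative of \<open>\<phi>\<close> at \<open>z\<close> in any direction \<open>v\<close> is at least \<open>- c * norm v\<close>.

  By the chain rule condition that derivative is bounded above by the support function of a
  weak-star closed convex set of functionals \<open>y' \<circ> T\<close>.  A support function that lies above
  \<open>- c * norm v\<close> forces the set to contain an element of norm at most \<open>c\<close>
  (\<open>weak_star_closed_convex_small_element\<close>).  In this element \<open>y'\<close> is a subgradient of
  the distance to \<open>y\<close> at a point other than \<open>y\<close>, so its norm is one, and \<open>T\<close> is a norm limit of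
  operators with surjectivity index at least \<open>b\<close>.  Hence the norm of \<open>y' \<circ> T\<close> is at least
  \<open>b > c\<close>, a contradiction.

  The small element comes from the Hahn--Banach theorem in its sublinear form, applied to
  the infimal convolution of the support function with \<open>c * norm\<close>.  Any linear functional
  below this convolution has norm at most \<open>c\<close> and lies below the support function; the
  latter puts it in the set, since a weak-star neighbourhood involves finitely many vectors
  only and a nearest point argument separates in finitely many coordinates.
\<close>

section \<open>Linear functionals below a sublinear one\<close>

text \<open>
  Only one inequality is demanded for scaling, and only for \<open>t > 0\<close>, since this passes directly
  to infima; equality follows by scaling back with \<open>1 / t\<close>, and \<open>q 0 = 0\<close> from \<open>q (2 *\<^sub>R 0) = 2 * q 0\<close>.
\<close>

definition sublinear :: "('a::real_vector \<Rightarrow> real) \<Rightarrow> bool" where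
  "sublinear q \<longleftrightarrow> (\<forall>x y. q (x + y) \<le> q x + q y) \<and> (\<forall>t x. t > 0 \<longrightarrow> q (t *\<^sub>R x) \<le> t * q x)"

lemma sublinear_add: "sublinear q \<Longrightarrow> q (x + y) \<le> q x + q y"
  by (simp add: sublinear_def)

lemma sublinear_scale:
  assumes "sublinear q" "t > 0"
  shows "q (t *\<^sub>R x) = t * q x"
proof (rule antisym)
  show "q (t *\<^sub>R x) \<le> t * q x"
    using assms by (simp add: sublinear_def)
  have "q ((1 / t) *\<^sub>R (t *\<^sub>R x)) \<le> (1 / t) * q (t *\<^sub>R x)"
    using assms unfolding sublinear_def by (meson zero_less_divide_1_iff)
  then show "t * q x \<le> q (t *\<^sub>R x)"
    using assms(2) by (simp add: field_simps)
qed

lemma sublinear_zero: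
  assumes "sublinear q" shows "q 0 = 0"
  using sublinear_scale[OF assms, of 2 0] by simp

lemma sublinear_minus:
  assumes "sublinear q" shows "- q (- x) \<le> q x"
  using sublinear_add[OF assms, of x "- x"] sublinear_zero[OF assms] by simp

text \<open>
  Subadditivity survives a pointwise infimum because the family is a chain: two members
  that nearly attain the infimum at \<open>x\<close> and at \<open>y\<close> can both be replaced by the smaller one.
\<close>

lemma sublinear_chain_INF:
  assumes "C \<noteq> {}" and sub: "\<And>q. q \<in> C \<Longrightarrow> sublinear q"
    and chain: "\<And>q r. q \<in> C \<Longrightarrow> r \<in> C \<Longrightarrow> q \<le> r \<or> r \<le> q"
    and bdd: "\<And>v. bdd_below ((\<lambda>q. q v) ` C)"
  shows "sublinear (\<lambda>v. INF q\<in>C. q v)"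
  unfolding sublinear_def
proof safe
  fix x y :: 'a
  let ?u = "\<lambda>v. INF q\<in>C. q v"
  have le: "?u (x + y) \<le> q x + r y" if "q \<in> C" "r \<in> C" for q r
  proof -
    obtain s where s: "s \<in> C" "s \<le> q" "s \<le> r"
      using chain[OF \<open>q \<in> C\<close> \<open>r \<in> C\<close>] \<open>q \<in> C\<close> \<open>r \<in> C\<close> by fast
    have "?u (x + y) \<le> s (x + y)"
      by (rule cINF_lower[OF bdd s(1)])
    also have "\<dots> \<le> s x + s y"
      by (rule sublinear_add[OF sub[OF s(1)]])
    also have "\<dots> \<le> q x + r y"
      by (rule add_mono[OF le_funD[OF s(2)] le_funD[OF s(3)]])
    finally show ?thesis .
  qed
  have "?u (x + y) - r y \<le> ?u x" if "r \<in> C" for r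
    using le[OF _ that] by (intro cINF_greatest[OF assms(1)]) (simp add: algebra_simps)
  then have "?u (x + y) - ?u x \<le> ?u y"
    by (intro cINF_greatest[OF assms(1)]) (simp add: algebra_simps)
  then show "?u (x + y) \<le> ?u x + ?u y" by simp
next
  fix t :: real and x :: 'a
  let ?u = "\<lambda>v. INF q\<in>C. q v"
  assume t: "t > 0"
  have "?u (t *\<^sub>R x) / t \<le> q x" if "q \<in> C" for q
    using cINF_lower[OF bdd that, of "t *\<^sub>R x"] sublinear_scale[OF sub[OF that] t, of x] t
    by (simp add: field_simps)
  then have "?u (t *\<^sub>R x) / t \<le> ?u x"
    by (intro cINF_greatest[OF assms(1)])
  then show "?u (t *\<^sub>R x) \<le> t * ?u x"
    using t by (simp add: field_simps)
qed

text \<open>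
  By Zorn's lemma, the infimum of a chain serves as its lower bound; it is finite because every
  sublinear \<open>q \<le> p\<close> satisfies \<open>- p (- v) \<le> - q (- v) \<le> q v\<close>.
\<close>

lemma minimal_sublinear_exists:
  assumes p: "sublinear p"
  obtains q where "sublinear q" "q \<le> p" "\<And>r. sublinear r \<Longrightarrow> r \<le> q \<Longrightarrow> r = q"
proof -
  define A where "A = {q. sublinear q \<and> q \<le> p}"
  have "\<exists>q\<in>A. \<forall>r\<in>A. r \<le> q \<longrightarrow> r = q"
  proof (rule predicate_Zorn)
    show "partial_order_on A (relation_of (\<lambda>a b. b \<le> a) A)"
      by (rule partial_order_on_relation_ofI) auto
  next
    fix C assume C: "C \<in> Chains (relation_of (\<lambda>a b. b \<le> a) A)"
    then have CA: "C \<subseteq> A" by (rule Chains_relation_of)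
    show "\<exists>u\<in>A. \<forall>a\<in>C. u \<le> a"
    proof (cases "C = {}")
      case True
      then show ?thesis using p by (auto simp: A_def)
    next
      case False
      have bdd: "bdd_below ((\<lambda>q. q v) ` C)" for v
      proof (intro bdd_belowI2)
        fix q assume "q \<in> C"
        then have "sublinear q" "q (- v) \<le> p (- v)"
          using CA by (auto simp: A_def le_fun_def)
        then show "- p (- v) \<le> q v"
          using sublinear_minus[of q v] by linarith
      qed
      have "sublinear (\<lambda>v. INF q\<in>C. q v)"
      proof (rule sublinear_chain_INF[OF False _ _ bdd])
        show "q \<in> C \<Longrightarrow> sublinear q" for q
          using CA by (auto simp: A_def)
        show "q \<in> C \<Longrightarrow> r \<in> C \<Longrightarrow> q \<le> r \<or> r \<le> q" for q r
          using C by (auto simp: Chains_def relation_of_def)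
      qed
      moreover have low: "(\<lambda>v. INF q\<in>C. q v) \<le> q" if "q \<in> C" for q
        using cINF_lower[OF bdd that] by (simp add: le_fun_def)
      moreover obtain q where "q \<in> C" "q \<le> p"
        using False CA by (auto simp: A_def)
      ultimately have "(\<lambda>v. INF q\<in>C. q v) \<in> A"
        unfolding A_def using order_trans[OF low] by blast
      then show ?thesis using low by blast
    qed
  qed
  then show thesis using that unfolding A_def
    by (metis (mono_tags, lifting) mem_Collect_eq order_trans)
qed

text \<open>
  For fixed \<open>u\<close>, the infimum over \<open>t \<ge> 0\<close> of \<open>q (w + t u) - t q u\<close> is again sublinear in \<open>w\<close>
  and lies below \<open>q\<close>.  Minimality makes it equal to \<open>q\<close>, and the value at \<open>t = 1\<close> then says that
  \<open>q\<close> is superadditive.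
\<close>

lemma minimal_sublinear_linear:
  assumes q: "sublinear q" and min: "\<And>r. sublinear r \<Longrightarrow> r \<le> q \<Longrightarrow> r = q"
  shows "linear q"
proof -
  have super: "q v + q u \<le> q (v + u)" for v u
  proof -
    define h where "h w t = q (w + t *\<^sub>R u) - t * q u" for w t
    define r where "r w = (INF t\<in>{0..}. h w t)" for w
    have scale: "q (t *\<^sub>R u) = t * q u" if "t \<ge> 0" for t
      using that sublinear_scale[OF q, of t u] sublinear_zero[OF q] by (cases "t = 0") auto
    have low: "- q (- w) \<le> h w t" if "t \<ge> 0" for w t
      using sublinear_add[OF q, of "w + t *\<^sub>R u" "- w"] scale[OF that] by (simp add: h_def)
    have le: "r w \<le> h w t" if "t \<ge> 0" for w t
      unfolding r_def using that low by (intro cINF_lower bdd_belowI2) auto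
    have ge: "m \<le> r w" if "\<And>t. t \<ge> 0 \<Longrightarrow> m \<le> h w t" for m w
      unfolding r_def using that by (intro cINF_greatest) auto
    have "sublinear r"
      unfolding sublinear_def
    proof safe
      fix x y
      have *: "r (x + y) \<le> h x s + h y t" if "s \<ge> 0" "t \<ge> 0" for s t
      proof -
        have "r (x + y) \<le> h (x + y) (s + t)"
          using that by (intro le) simp
        also have "\<dots> \<le> h x s + h y t"
          using sublinear_add[OF q, of "x + s *\<^sub>R u" "y + t *\<^sub>R u"]
          by (simp add: h_def algebra_simps)
        finally show ?thesis .
      qed
      have "r (x + y) - h y t \<le> r x" if "t \<ge> 0" for t
        using *[OF _ that] by (intro ge) (simp add: algebra_simps)
      then have "r (x + y) - r x \<le> r y"
        by (intro ge) (simp add: algebra_simps)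
      then show "r (x + y) \<le> r x + r y" by simp
    next
      fix l :: real and x assume l: "l > 0"
      have "r (l *\<^sub>R x) / l \<le> h x t" if "t \<ge> 0" for t
      proof -
        have "r (l *\<^sub>R x) \<le> h (l *\<^sub>R x) (l * t)"
          using that l by (intro le) simp
        also have "\<dots> = l * h x t"
          using sublinear_scale[OF q l, of "x + t *\<^sub>R u"] by (simp add: h_def algebra_simps)
        finally show ?thesis using l by (simp add: field_simps)
      qed
      then have "r (l *\<^sub>R x) / l \<le> r x" by (rule ge)
      then show "r (l *\<^sub>R x) \<le> l * r x" using l by (simp add: field_simps)
    qed
    moreover have "r \<le> q"
      using le[of 0] by (simp add: h_def le_fun_def)
    ultimately have "r = q" by (rule min)
    then show ?thesis using le[of 1 v] by (simp add: h_def)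
  qed
  have add: "q (x + y) = q x + q y" for x y
    using super[of x y] sublinear_add[OF q, of x y] by simp
  have neg: "q (- x) = - q x" for x
    using add[of x "- x"] sublinear_zero[OF q] by simp
  show ?thesis
  proof (rule linearI)
    show "q (t *\<^sub>R x) = t *\<^sub>R q x" for t x
    proof (cases t "0::real" rule: linorder_cases)
      case less
      then show ?thesis
        using sublinear_scale[OF q, of "- t" x] neg[of "t *\<^sub>R x"] by simp
    qed (use sublinear_zero[OF q] sublinear_scale[OF q] in auto)
  qed (rule add)
qed

theorem hahn_banach_sublinear:
  assumes "sublinear p"
  obtains l where "linear l" "\<And>v. l v \<le> p v"
  using minimal_sublinear_exists[OF assms] minimal_sublinear_linear
  by (metis le_funD)

section \<open>Weak-star closed convex sets of functionals\<close>

text \<open>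
  This is the separation of a convex set from the origin in the Euclidean space with
  coordinates \<open>F\<close>.  Sequences that minimise the sum of squares are Cauchy in each coordinate by the
  parallelogram law.  The limit \<open>w\<close> is the point nearest to the origin in the closure, and
  comparing it with the points of the segment from \<open>w\<close> to a member \<open>a\<close> bounds their inner
  product from below.  The inner product with \<open>w\<close> is evaluation at a linear combination of the
  vectors in \<open>F\<close>.
\<close>

lemma convex_coordinates_separated:
  fixes A :: "('a::real_normed_vector \<Rightarrow>\<^sub>L real) set"
  assumes F: "finite F" and A: "convex A" "A \<noteq> {}"
    and far: "\<And>a. a \<in> A \<Longrightarrow> e \<le> (\<Sum>v\<in>F. (blinfun_apply a v)\<^sup>2)"
  obtains u where "\<And>a. a \<in> A \<Longrightarrow> e \<le> blinfun_apply a u"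
proof -
  define Q where "Q a = (\<Sum>v\<in>F. (blinfun_apply a v)\<^sup>2)" for a :: "'a \<Rightarrow>\<^sub>L real"
  define d where "d = (INF a\<in>A. Q a)"
  have Q0: "0 \<le> Q a" for a
    by (simp add: Q_def sum_nonneg)
  have dle: "d \<le> Q a" if "a \<in> A" for a
    unfolding d_def using that Q0 by (intro cINF_lower bdd_belowI2)
  have ed: "e \<le> d"
    unfolding d_def using far A(2) by (intro cINF_greatest) (auto simp: Q_def)
  have "\<exists>a\<in>A. Q a < d + 1 / real (Suc n)" for n
    using cInf_lessD[of "Q ` A" "d + 1 / real (Suc n)"] A(2) unfolding d_def by auto
  then obtain s where sA: "\<And>n. s n \<in> A" and sQ: "\<And>n. Q (s n) < d + 1 / real (Suc n)"
    by metis
  have diff: "Q (s n - s m) \<le> 2 / real (Suc n) + 2 / real (Suc m)" for n m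
  proof -
    \<comment> \<open>parallelogram law; the midpoint cannot fall below the infimum\<close>
    have "(1/2) *\<^sub>R s n + (1/2) *\<^sub>R s m \<in> A"
      using A(1) sA by (intro convexD) auto
    then have "d \<le> Q ((1/2) *\<^sub>R s n + (1/2) *\<^sub>R s m)" by (rule dle)
    moreover have "Q (s n - s m) = 2 * Q (s n) + 2 * Q (s m) - 4 * Q ((1/2) *\<^sub>R s n + (1/2) *\<^sub>R s m)"
      unfolding Q_def sum_distrib_left sum.distrib[symmetric] sum_subtractf[symmetric]
      by (intro sum.cong refl)
        (simp add: blinfun.bilinear_simps power2_eq_square field_simps)
    ultimately show ?thesis using sQ[of n] sQ[of m] by simp
  qed
  have "Cauchy (\<lambda>n. blinfun_apply (s n) v)" if v: "v \<in> F" for v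
  proof (rule metric_CauchyI)
    fix r :: real assume r: "r > 0"
    obtain N where N: "4 / r\<^sup>2 < real N"
      using reals_Archimedean2 by blast
    have "dist (blinfun_apply (s m) v) (blinfun_apply (s n) v) < r" if mn: "m \<ge> N" "n \<ge> N" for m n
    proof -
      have N0: "0 < real N" using N r
        by (meson divide_nonneg_nonneg le_less_trans zero_le_numeral zero_le_power2)
      have small: "2 / real (Suc k) < r\<^sup>2 / 2" if "k \<ge> N" for k
      proof -
        have "4 / r\<^sup>2 < real (Suc k)" using N that by linarith
        then show ?thesis using r by (simp add: field_simps)
      qed
      have "Q (s m - s n) < r\<^sup>2"
        using diff[of m n] small[OF mn(1)] small[OF mn(2)] by simp
      moreover have "(blinfun_apply (s m - s n) v)\<^sup>2 \<le> Q (s m - s n)"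
        unfolding Q_def using F v by (intro member_le_sum) auto
      ultimately have "(blinfun_apply (s m - s n) v)\<^sup>2 < r\<^sup>2" by simp
      then have "\<bar>blinfun_apply (s m - s n) v\<bar> < r"
        using r by (metis abs_of_pos power2_less_imp_less power2_abs less_imp_le)
      then show ?thesis by (simp add: dist_real_def blinfun.bilinear_simps)
    qed
    then show "\<exists>M. \<forall>m\<ge>M. \<forall>n\<ge>M. dist (blinfun_apply (s m) v) (blinfun_apply (s n) v) < r"
      by blast
  qed
  then obtain w where w: "\<And>v. v \<in> F \<Longrightarrow> (\<lambda>n. blinfun_apply (s n) v) \<longlonglongrightarrow> w v"
    unfolding Cauchy_convergent_iff convergent_def by metis
  have wd: "(\<Sum>v\<in>F. (w v)\<^sup>2) \<le> d"
  proof (rule LIMSEQ_le)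
    show "(\<lambda>n. Q (s n)) \<longlonglongrightarrow> (\<Sum>v\<in>F. (w v)\<^sup>2)"
      unfolding Q_def by (intro tendsto_intros w)
    show "(\<lambda>n. d + 1 / real (Suc n)) \<longlonglongrightarrow> d"
      using tendsto_add[OF tendsto_const[of d] LIMSEQ_inverse_real_of_nat] by (simp add: inverse_eq_divide)
    show "\<exists>N. \<forall>n\<ge>N. Q (s n) \<le> d + 1 / real (Suc n)"
      using sQ less_imp_le by blast
  qed
  have "d \<le> (\<Sum>v\<in>F. w v * blinfun_apply a v)" if a: "a \<in> A" for a
  proof -
    define b where "b = (\<Sum>v\<in>F. w v * blinfun_apply a v)"
    have seg: "d \<le> (\<Sum>v\<in>F. ((1 - t) * w v + t * blinfun_apply a v)\<^sup>2)" if t: "0 < t" "t < 1" for t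
    proof (rule LIMSEQ_le_const)
      show "(\<lambda>n. Q ((1 - t) *\<^sub>R s n + t *\<^sub>R a))
          \<longlonglongrightarrow> (\<Sum>v\<in>F. ((1 - t) * w v + t * blinfun_apply a v)\<^sup>2)"
        unfolding Q_def blinfun.bilinear_simps real_scaleR_def by (intro tendsto_intros w)
      show "\<exists>N. \<forall>n\<ge>N. d \<le> Q ((1 - t) *\<^sub>R s n + t *\<^sub>R a)"
        using t a sA A(1) by (intro exI allI impI dle convexD) auto
    qed
    have ineq: "(2 - t) * d \<le> 2 * (1 - t) * b + t * Q a" if t: "0 < t" "t < 1" for t
    proof -
      have "(\<Sum>v\<in>F. ((1 - t) * w v + t * blinfun_apply a v)\<^sup>2)
          = (1 - t)\<^sup>2 * (\<Sum>v\<in>F. (w v)\<^sup>2) + 2 * t * (1 - t) * b + t\<^sup>2 * Q a"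
        unfolding Q_def b_def sum_distrib_left sum.distrib[symmetric]
        by (intro sum.cong refl) (simp add: power2_eq_square algebra_simps)
      also have "\<dots> \<le> (1 - t)\<^sup>2 * d + 2 * t * (1 - t) * b + t\<^sup>2 * Q a"
        using mult_left_mono[OF wd, of "(1 - t)\<^sup>2"] by simp
      finally have "d \<le> (1 - t)\<^sup>2 * d + 2 * t * (1 - t) * b + t\<^sup>2 * Q a"
        using seg[OF t] by simp
      then have "t * ((2 - t) * d) \<le> t * (2 * (1 - t) * b + t * Q a)"
        by (simp add: power2_eq_square algebra_simps)
      then show ?thesis using t by simp
    qed
    have ev: "\<forall>\<^sub>F t in at_right (0::real). t \<in> {0<..<1}"
      by (rule eventually_at_right_real) simp
    have "(2 - 0) * d \<le> 2 * (1 - 0) * b + 0 * Q a"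
    proof (rule tendsto_le)
      show "((\<lambda>t. (2 - t) * d) \<longlongrightarrow> (2 - 0) * d) (at_right 0)"
        by (intro tendsto_intros)
      show "((\<lambda>t. 2 * (1 - t) * b + t * Q a) \<longlongrightarrow> 2 * (1 - 0) * b + 0 * Q a) (at_right 0)"
        by (intro tendsto_intros)
      show "\<forall>\<^sub>F t in at_right 0. (2 - t) * d \<le> 2 * (1 - t) * b + t * Q a"
        using ev by (rule eventually_mono) (use ineq in auto)
    qed simp
    then show ?thesis by (simp add: b_def)
  qed
  then have "e \<le> blinfun_apply a (\<Sum>v\<in>F. w v *\<^sub>R v)" if "a \<in> A" for a
    using ed that by (fastforce simp: blinfun.sum_right blinfun.bilinear_simps)
  then show thesis by (rule that)
qed

lemma weak_star_closed_coordinates: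
  fixes l :: "'a::real_normed_vector \<Rightarrow>\<^sub>L real"
  assumes "closedin weak_star_topology A" "l \<notin> A"
  obtains F e where "finite F" "e > 0" "\<And>a. a \<in> A \<Longrightarrow> \<exists>v\<in>F. e \<le> \<bar>blinfun_apply (l - a) v\<bar>"
proof -
  have "openin weak_star_topology (- A)"
    using assms(1) by (simp add: closedin_def strong_operator_topology_topspace Compl_eq_Diff_UNIV)
  then obtain W where W: "open W" "- A = blinfun_apply -` W"
    unfolding strong_operator_topology_def openin_pullback_topology by auto
  have "openin (product_topology (\<lambda>i. euclidean) UNIV) W" "blinfun_apply l \<in> W"
    using W assms(2) unfolding open_fun_def by auto
  from product_topology_open_contains_basis[OF this]
  obtain X where X: "blinfun_apply l \<in> (\<Pi>\<^sub>E i\<in>UNIV. X i)" "\<And>i. open (X i)"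
      "finite {i. X i \<noteq> UNIV}" "(\<Pi>\<^sub>E i\<in>UNIV. X i) \<subseteq> W"
    by auto
  define F where "F = {i. X i \<noteq> UNIV}"
  have "\<exists>r>0. ball (blinfun_apply l v) r \<subseteq> X v" for v
    using X(1,2) by (auto simp: open_contains_ball PiE_def)
  then obtain r where r: "\<And>v. r v > 0" "\<And>v. ball (blinfun_apply l v) (r v) \<subseteq> X v"
    by metis
  define e where "e = Min (insert 1 (r ` F))"
  have F: "finite F" using X(3) by (simp add: F_def)
  have e: "e > 0" "\<And>v. v \<in> F \<Longrightarrow> e \<le> r v"
    using F r by (auto simp: e_def)
  have "\<exists>v\<in>F. e \<le> \<bar>blinfun_apply (l - a) v\<bar>" if "a \<in> A" for a
  proof (rule ccontr)
    assume "\<not> ?thesis"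
    then have "blinfun_apply a v \<in> X v" if "v \<in> F" for v
      using that e(2)[OF that] r(2)[of v]
      by (fastforce simp: dist_real_def blinfun.bilinear_simps)
    then have "blinfun_apply a \<in> (\<Pi>\<^sub>E i\<in>UNIV. X i)"
      by (auto simp: F_def)
    then have "a \<in> - A" using X(4) W(2) by auto
    then show False using that by simp
  qed
  then show thesis using that F e(1) by blast
qed

text \<open>
  A bipolar theorem: if \<open>l\<close> were outside, finitely many vectors would witness this, and the
  coordinatewise separation of \<open>l - A\<close> from the origin would yield one vector \<open>u\<close> at which \<open>l\<close>
  exceeds the support function of \<open>A\<close>.
\<close>

lemma weak_star_closed_convex_memI:
  fixes l :: "'a::real_normed_vector \<Rightarrow>\<^sub>L real"
  assumes A: "closedin weak_star_topology A" "convex A" "A \<noteq> {}"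
    and below: "\<And>v s. (\<And>a. a \<in> A \<Longrightarrow> blinfun_apply a v \<le> s) \<Longrightarrow> blinfun_apply l v \<le> s"
  shows "l \<in> A"
proof (rule ccontr)
  assume "l \<notin> A"
  then obtain F e where F: "finite F" "e > 0"
      and far: "\<And>a. a \<in> A \<Longrightarrow> \<exists>v\<in>F. e \<le> \<bar>blinfun_apply (l - a) v\<bar>"
    using weak_star_closed_coordinates[OF A(1)] by metis
  have "e\<^sup>2 \<le> (\<Sum>v\<in>F. (blinfun_apply b v)\<^sup>2)" if "b \<in> (\<lambda>a. l - a) ` A" for b
  proof -
    obtain v where v: "v \<in> F" "e \<le> \<bar>blinfun_apply b v\<bar>"
      using far \<open>b \<in> _\<close> by auto
    then have "e\<^sup>2 \<le> (blinfun_apply b v)\<^sup>2"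
      using F(2) by (metis abs_le_square_iff abs_of_pos)
    also have "\<dots> \<le> (\<Sum>v\<in>F. (blinfun_apply b v)\<^sup>2)"
      using F v by (intro member_le_sum) auto
    finally show ?thesis .
  qed
  moreover have "convex ((\<lambda>a. l - a) ` A)"
    using convex_translation[OF convex_negations[OF A(2)], of l] by (simp add: image_image)
  ultimately obtain u where u: "\<And>b. b \<in> (\<lambda>a. l - a) ` A \<Longrightarrow> e\<^sup>2 \<le> blinfun_apply b u"
    using convex_coordinates_separated[OF F(1)] A(3) by blast
  have "blinfun_apply l u \<le> blinfun_apply l u - e\<^sup>2"
  proof (rule below)
    fix a assume "a \<in> A"
    then show "blinfun_apply a u \<le> blinfun_apply l u - e\<^sup>2"
      using u[of "l - a"] by (simp add: blinfun.bilinear_simps)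
  qed
  then show False using F(2) by simp
qed

text \<open>
  The support function \<open>\<sigma>\<close> of \<open>A\<close> may be infinite, so it is represented by its real upper bounds
  \<open>s\<close> at \<open>w\<close>, that is \<open>P w s\<close>.  The infimal convolution
  \<open>p v = inf {\<sigma> w + c * norm (v - w)}\<close> is finite by the assumed lower bound on \<open>\<sigma>\<close>.  Taking \<open>w = 0\<close>
  shows \<open>p \<le> c * norm\<close>, and taking \<open>w = v\<close> shows \<open>p \<le> \<sigma>\<close>; a linear functional below \<open>p\<close> inherits
  both bounds.
\<close>

lemma weak_star_closed_convex_small_element:
  fixes A :: "('a::real_normed_vector \<Rightarrow>\<^sub>L real) set"
  assumes A: "closedin weak_star_topology A" "convex A" "A \<noteq> {}"
    and above: "\<And>v s. (\<And>a. a \<in> A \<Longrightarrow> blinfun_apply a v \<le> s) \<Longrightarrow> - c * norm v \<le> s"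
    and c: "c \<ge> 0"
  obtains a where "a \<in> A" "norm a \<le> c"
proof -
  define P where "P w s \<longleftrightarrow> (\<forall>a\<in>A. blinfun_apply a w \<le> s)" for w s
  define G where "G v = {s + c * norm (v - w) | w s. P w s}" for v
  define p where "p v = Inf (G v)" for v
  have low: "- c * norm v \<le> s + c * norm (v - w)" if "P w s" for v w s
  proof -
    have "c * norm w \<le> c * (norm v + norm (v - w))"
      using c norm_triangle_sub[of w v] by (intro mult_left_mono) (auto simp: norm_minus_commute)
    then show ?thesis using above[of w s] that by (auto simp: P_def algebra_simps)
  qed
  have "bdd_below (G v)" for v
    using low by (intro bdd_belowI[of _ "- c * norm v"]) (auto simp: G_def)
  then have le: "p v \<le> s + c * norm (v - w)" if "P w s" for v w s
    unfolding p_def using that by (intro cInf_lower) (auto simp: G_def)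
  have P0: "P 0 0" by (simp add: P_def)
  have ge: "m \<le> p v" if "\<And>w s. P w s \<Longrightarrow> m \<le> s + c * norm (v - w)" for m v
    unfolding p_def using that P0 by (intro cInf_greatest) (auto simp: G_def)
  have "sublinear p"
    unfolding sublinear_def
  proof safe
    fix x y
    have *: "p (x + y) \<le> (s + c * norm (x - w)) + (s' + c * norm (y - w'))"
      if "P w s" "P w' s'" for w s w' s'
    proof -
      have "P (w + w') (s + s')"
        using that by (auto simp: P_def blinfun.bilinear_simps intro: add_mono)
      then have "p (x + y) \<le> (s + s') + c * norm ((x + y) - (w + w'))" by (rule le)
      also have "c * norm ((x + y) - (w + w')) \<le> c * (norm (x - w) + norm (y - w'))"
        using c by (intro mult_left_mono norm_diff_triangle_ineq)
      finally show ?thesis by (simp add: algebra_simps)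
    qed
    have "p (x + y) - (s' + c * norm (y - w')) \<le> p x" if "P w' s'" for w' s'
      using *[OF _ that] by (intro ge) (simp add: algebra_simps)
    then have "p (x + y) - p x \<le> p y"
      by (intro ge) (simp add: algebra_simps)
    then show "p (x + y) \<le> p x + p y" by simp
  next
    fix t :: real and x assume t: "t > 0"
    have "p (t *\<^sub>R x) / t \<le> s + c * norm (x - w)" if "P w s" for w s
    proof -
      have "P (t *\<^sub>R w) (t * s)"
        using that t by (auto simp: P_def blinfun.bilinear_simps)
      then have "p (t *\<^sub>R x) \<le> t * s + c * norm (t *\<^sub>R x - t *\<^sub>R w)" by (rule le)
      also have "norm (t *\<^sub>R x - t *\<^sub>R w) = t * norm (x - w)"
        using t by (simp flip: scaleR_diff_right)
      finally show ?thesis using t by (simp add: field_simps)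
    qed
    then have "p (t *\<^sub>R x) / t \<le> p x" by (rule ge)
    then show "p (t *\<^sub>R x) \<le> t * p x" using t by (simp add: field_simps)
  qed
  then obtain l where l: "linear l" "\<And>v. l v \<le> p v"
    by (rule hahn_banach_sublinear) blast
  have up: "l v \<le> c * norm v" for v
    using l(2)[of v] le[OF P0, of v] by simp
  have abs: "\<bar>l v\<bar> \<le> norm v * c" for v
    using up[of v] up[of "- v"] linear_neg[OF l(1), of v] by (simp add: mult.commute)
  then have bl: "bounded_linear l"
    using l(1) by (intro bounded_linear.intro bounded_linear_axioms.intro) auto
  have app: "blinfun_apply (Blinfun l) = l"
    by (rule bounded_linear_Blinfun_apply[OF bl])
  show thesis
  proof (rule that)
    show "norm (Blinfun l) \<le> c"
      using abs c by (intro norm_blinfun_bound) (auto simp: app mult.commute)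
    show "Blinfun l \<in> A"
    proof (rule weak_star_closed_convex_memI[OF A])
      fix v s assume "\<And>a. a \<in> A \<Longrightarrow> blinfun_apply a v \<le> s"
      then have "P v s" by (simp add: P_def)
      then show "blinfun_apply (Blinfun l) v \<le> s"
        using l(2)[of v] le[of v s v] by (simp add: app)
    qed
  qed
qed

section \<open>Almost minimal points of continuous functions\<close>

text \<open>
  Write \<open>u \<in> D x\<close> if \<open>u\<close> lies in \<open>S\<close> and \<open>\<phi> u + c * dist u x \<le> \<phi> x\<close>.  This is an order relation, and
  the theorem asks for a point \<open>z \<in> D x0\<close> such that \<open>D z\<close> contains only \<open>z\<close>.
  Starting from \<open>x0\<close>, move repeatedly to a point of \<open>D x\<close> that realises at least half of the possible decrease of \<open>\<phi>\<close>.  The distances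
  between the iterates are controlled by the decrease of \<open>\<phi>\<close>, so they converge.  A point of
  \<open>D z\<close> for the limit \<open>z\<close> lies in every \<open>D (s n)\<close>, and because half of the gap is closed at
  each step, its value cannot be less than \<open>\<phi> z\<close>.
\<close>

theorem ekeland_variational_principle:
  fixes \<phi> :: "'a::metric_space \<Rightarrow> real"
  assumes S: "complete S" and cont: "continuous_on S \<phi>" and bdd: "bdd_below (\<phi> ` S)"
    and x0: "x0 \<in> S" and c: "c > 0"
  obtains z where "z \<in> S" "\<phi> z + c * dist z x0 \<le> \<phi> x0"
    "\<And>x. x \<in> S \<Longrightarrow> x \<noteq> z \<Longrightarrow> \<phi> z < \<phi> x + c * dist x z"
proof -
  define D where "D x = {u \<in> S. \<phi> u + c * dist u x \<le> \<phi> x}" for x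
  have D_trans: "v \<in> D x" if "v \<in> D u" "u \<in> D x" for u v x
  proof -
    have "c * dist v x \<le> c * (dist v u + dist u x)"
      using c by (intro mult_left_mono dist_triangle) auto
    then show ?thesis using that by (auto simp: D_def algebra_simps)
  qed
  have "\<exists>y\<in>D x. \<forall>u\<in>D x. \<phi> y \<le> (\<phi> x + \<phi> u) / 2" if x: "x \<in> S" for x
  proof -
    have xD: "x \<in> D x" using x by (simp add: D_def)
    have bddD: "bdd_below (\<phi> ` D x)"
      using bdd by (rule bdd_below_mono) (auto simp: D_def)
    define m where "m = (INF u\<in>D x. \<phi> u)"
    have m: "m \<le> \<phi> u" if "u \<in> D x" for u
      unfolding m_def by (rule cINF_lower[OF bddD that])
    \<comment> \<open>if \<open>\<phi> x\<close> is already the infimum, no decrease is possible and \<open>x\<close> itself is taken\<close>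
    show ?thesis
    proof (cases "m = \<phi> x")
      case True
      then show ?thesis using xD m by (intro bexI[of _ x]) auto
    next
      case False
      then have "m < (\<phi> x + m) / 2" using m[OF xD] by simp
      then obtain y where y: "y \<in> D x" "\<phi> y < (\<phi> x + m) / 2"
        unfolding m_def using cInf_lessD[of "\<phi> ` D x"] xD by blast
      then show ?thesis using m by (intro bexI[of _ y]) force+
    qed
  qed
  then obtain g where gD: "\<And>x. x \<in> S \<Longrightarrow> g x \<in> D x"
    and g: "\<And>x u. x \<in> S \<Longrightarrow> u \<in> D x \<Longrightarrow> \<phi> (g x) \<le> (\<phi> x + \<phi> u) / 2"
    by metis
  define s where "s n = (g ^^ n) x0" for n
  have sS: "s n \<in> S" for n
    by (induction n) (use x0 gD in \<open>auto simp: s_def D_def\<close>)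
  have sD: "s m \<in> D (s n)" if "n \<le> m" for n m
    using that
  proof (induction m rule: dec_induct)
    case base
    show ?case using sS by (simp add: D_def)
  next
    case (step m)
    have "s (Suc m) \<in> D (s m)" using gD[OF sS[of m]] by (simp add: s_def)
    then show ?case using step D_trans by blast
  qed
  have dec: "\<phi> (s m) + c * dist (s m) (s n) \<le> \<phi> (s n)" if "n \<le> m" for n m
    using sD[OF that] by (simp add: D_def)
  have "decseq (\<lambda>n. \<phi> (s n))"
  proof (rule decseq_SucI)
    fix n
    have "0 \<le> c * dist (s (Suc n)) (s n)" using c by simp
    then show "\<phi> (s (Suc n)) \<le> \<phi> (s n)" using dec[of n "Suc n"] by linarith
  qed
  moreover obtain b where "\<And>n. b \<le> \<phi> (s n)"
    using bdd sS unfolding bdd_below_def by blast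
  ultimately obtain L where L: "(\<lambda>n. \<phi> (s n)) \<longlonglongrightarrow> L" "\<And>n. L \<le> \<phi> (s n)"
    using decseq_convergent[of "\<lambda>n. \<phi> (s n)" b] by metis
  have "Cauchy s"
  proof (rule metric_CauchyI)
    fix e :: real assume e: "e > 0"
    have "\<forall>\<^sub>F n in sequentially. \<phi> (s n) < L + c * e / 2"
      using L(1) c e by (intro order_tendstoD(2)) auto
    then obtain N where N: "\<phi> (s N) < L + c * e / 2"
      by (auto simp: eventually_sequentially)
    have near: "dist (s m) (s N) < e / 2" if "m \<ge> N" for m
    proof -
      have "c * dist (s m) (s N) < c * (e / 2)"
        using dec[OF that] L(2)[of m] N by simp
      then show ?thesis using c by simp
    qed
    have "dist (s m) (s n) < e" if "m \<ge> N" "n \<ge> N" for m n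
      using near[OF that(1)] near[OF that(2)] dist_triangle2[of "s m" "s n" "s N"] by simp
    then show "\<exists>M. \<forall>m\<ge>M. \<forall>n\<ge>M. dist (s m) (s n) < e" by blast
  qed
  then obtain z where z: "z \<in> S" "s \<longlonglongrightarrow> z"
    using S sS unfolding complete_def by blast
  have \<phi>z: "(\<lambda>n. \<phi> (s n)) \<longlonglongrightarrow> \<phi> z"
    using cont z sS by (auto simp: continuous_on_sequentially o_def)
  have zD: "z \<in> D (s n)" for n
  proof -
    have "\<phi> z + c * dist z (s n) \<le> \<phi> (s n)"
    proof (rule LIMSEQ_le_const2)
      show "(\<lambda>m. \<phi> (s m) + c * dist (s m) (s n)) \<longlonglongrightarrow> \<phi> z + c * dist z (s n)"
        by (intro tendsto_intros \<phi>z z(2))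
    qed (use dec in blast)
    then show ?thesis using z(1) by (simp add: D_def)
  qed
  show thesis
  proof (rule that)
    show "z \<in> S" by (rule z(1))
    show "\<phi> z + c * dist z x0 \<le> \<phi> x0"
      using zD[of 0] by (simp add: D_def s_def)
    fix x assume x: "x \<in> S" "x \<noteq> z"
    show "\<phi> z < \<phi> x + c * dist x z"
    proof (rule ccontr)
      assume neg: "\<not> ?thesis"
      then have "x \<in> D z" using x(1) by (simp add: D_def)
      then have xD: "x \<in> D (s n)" for n using zD D_trans by blast
      have half: "\<phi> (s (Suc n)) \<le> (\<phi> (s n) + \<phi> x) / 2" for n
        using g[OF sS xD] by (simp add: s_def)
      have "\<phi> z \<le> (\<phi> z + \<phi> x) / 2"
      proof (rule LIMSEQ_le)
        show "(\<lambda>n. \<phi> (s (Suc n))) \<longlonglongrightarrow> \<phi> z" using \<phi>z by (rule LIMSEQ_Suc)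
        show "(\<lambda>n. (\<phi> (s n) + \<phi> x) / 2) \<longlonglongrightarrow> (\<phi> z + \<phi> x) / 2"
          by (intro tendsto_intros \<phi>z) simp
      qed (use half in blast)
      moreover have "0 < c * dist x z" using c x(2) by simp
      ultimately show False using neg by simp
    qed
  qed
qed

section \<open>Subgradients of the distance and the surjectivity index\<close>

text \<open>
  The distance is 1-Lipschitz, which bounds the norm by one; it drops at unit rate from \<open>v\<close>
  towards \<open>y\<close>, which gives the converse.
\<close>

lemma norm_clarke_subgradient_dist_fun:
  assumes y': "y' \<in> clarke_subdifferential (dist_fun y) v" and ne: "v \<noteq> y"
  shows "norm y' = 1"
proof (rule antisym)
  have sub: "norm (v - y) + blinfun_apply y' (w - v) \<le> norm (w - y)" for w
    using y' by (simp add: clarke_subdifferential_dist_fun)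
  have up: "blinfun_apply y' u \<le> norm u" for u
    using sub[of "v + u"] norm_triangle_ineq[of "v - y" u] by (simp add: algebra_simps)
  have "\<bar>blinfun_apply y' u\<bar> \<le> norm u" for u
    using up[of u] up[of "- u"] by (simp add: blinfun.bilinear_simps)
  then show "norm y' \<le> 1"
    by (intro norm_blinfun_bound) auto
  have "norm (v - y) \<le> blinfun_apply y' (v - y)"
    using sub[of y] by (simp add: blinfun.bilinear_simps)
  also have "\<dots> \<le> norm y' * norm (v - y)"
    using norm_blinfun[of y' "v - y"] by simp
  finally show "1 \<le> norm y'" using ne by simp
qed

lemma surjectivity_index_le:
  fixes y' :: "'b::real_normed_vector \<Rightarrow>\<^sub>L real"
  assumes "norm y' = 1"
  shows "surjectivity_index T \<le> ereal (norm (y' o\<^sub>L T))"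
  unfolding surjectivity_index_def co_norm_def
  using assms by (intro INF_lower2[where i = y']) (auto simp: dual_map.rep_eq)

text \<open>
  The chain rule condition involves the closure of the convex hull, whereas the surjectivity
  index is bounded on the convex hull only.  For a fixed unit functional the estimate
  passes to norm limits of operators.
\<close>

lemma surjectivity_index_bound_closure:
  fixes y' :: "'b::real_normed_vector \<Rightarrow>\<^sub>L real"
  assumes bound: "\<And>T. T \<in> \<T> \<Longrightarrow> ereal c \<le> surjectivity_index T"
    and T: "T \<in> closure \<T>" and y': "norm y' = 1"
  shows "c \<le> norm (y' o\<^sub>L T)"
proof -
  have "closed {T. c \<le> norm (y' o\<^sub>L T)}"
    by (intro closed_Collect_le continuous_intros
        bounded_linear.continuous_on[OF bounded_bilinear.bounded_linear_right[OF bounded_bilinear_blinfun_compose]])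
  moreover have "\<T> \<subseteq> {T. c \<le> norm (y' o\<^sub>L T)}"
    using order_trans[OF bound surjectivity_index_le[OF y']] by auto
  ultimately show ?thesis using closure_minimal T by blast
qed

lemma upper_dini_lower_bound:
  assumes z: "eventually (\<lambda>x. \<phi> z \<le> \<phi> x + c * dist x z) (at z)"
  shows "ereal (- c * norm v) \<le> upper_dini \<phi> z v"
  unfolding upper_dini_def
proof (rule le_Limsup)
  have z': "eventually (\<lambda>x. \<phi> z \<le> \<phi> x + c * dist x z) (nhds z)"
    using z by (simp add: eventually_nhds_conv_at)
  have "((\<lambda>t. z + t *\<^sub>R v) \<longlongrightarrow> z + 0 *\<^sub>R v) (at_right 0)"
    by (intro tendsto_intros)
  then have "filterlim (\<lambda>t. z + t *\<^sub>R v) (nhds z) (at_right 0)" by simp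
  from eventually_compose_filterlim[OF z' this]
  have "\<forall>\<^sub>F t in at_right 0. \<phi> z \<le> \<phi> (z + t *\<^sub>R v) + c * dist (z + t *\<^sub>R v) z" .
  then show "\<forall>\<^sub>F t in at_right 0. ereal (- c * norm v) \<le> ereal ((\<phi> (z + t *\<^sub>R v) - \<phi> z) / t)"
    using eventually_at_right_less[of "0::real"]
    by eventually_elim (simp add: dist_norm field_simps)
qed simp

lemma pseudo_Jacobian_real_upper:
  fixes \<phi> :: "'a::real_normed_vector \<Rightarrow> real"
  assumes J: "pseudo_Jacobian \<phi> x J" and s: "\<And>a. a \<in> J \<Longrightarrow> blinfun_apply a v \<le> s"
  shows "upper_dini \<phi> x v \<le> ereal s"
proof -
  have "upper_dini (\<lambda>u. blinfun_apply id_blinfun (\<phi> u)) x v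
      \<le> (SUP T\<in>J. ereal (blinfun_apply id_blinfun (blinfun_apply T v)))"
    using J unfolding pseudo_Jacobian_def by blast
  also have "\<dots> \<le> ereal s"
    using s by (intro SUP_least) simp
  finally show ?thesis by simp
qed

section \<open>Images of balls\<close>

text \<open>
  An almost minimal point would put a functional of norm at most \<open>c\<close> into the chain set, all of
  whose elements have norm at least \<open>b\<close>.
\<close>

lemma chain_rule_no_almost_minimizer:
  assumes chain: "chain_rule_condition U f Jf" and z: "z \<in> U" "y \<noteq> f z"
    and min: "eventually (\<lambda>x. norm (f z - y) \<le> norm (f x - y) + c * dist x z) (at z)"
    and c: "0 \<le> c" "c < b"
    and bound: "\<And>T. T \<in> convex hull (Jf z) \<Longrightarrow> ereal b \<le> surjectivity_index T"
  shows False
proof -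
  let ?A = "chain_set f Jf z y"
  have A: "closedin weak_star_topology ?A" "convex ?A"
    and J: "pseudo_Jacobian (dist_fun y \<circ> f) z ?A"
    using chain z by (auto simp: chain_rule_condition_def)
  have ne: "?A \<noteq> {}" using J by (simp add: pseudo_Jacobian_def)
  obtain a where a: "a \<in> ?A" "norm a \<le> c"
  proof (rule weak_star_closed_convex_small_element[OF A ne _ c(1)])
    fix v s assume "\<And>a. a \<in> ?A \<Longrightarrow> blinfun_apply a v \<le> s"
    then have "upper_dini (dist_fun y \<circ> f) z v \<le> ereal s"
      by (rule pseudo_Jacobian_real_upper[OF J])
    moreover have "ereal (- c * norm v) \<le> upper_dini (dist_fun y \<circ> f) z v"
      using min by (intro upper_dini_lower_bound) (simp add: dist_fun_def)
    ultimately show "- c * norm v \<le> s"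
      using order_trans by fastforce
  qed
  then obtain y' T where yT: "a = y' o\<^sub>L T" "y' \<in> clarke_subdifferential (dist_fun y) (f z)"
      "T \<in> closure (convex hull (Jf z))"
    by (auto simp: chain_set_def)
  have "norm y' = 1"
    using norm_clarke_subgradient_dist_fun[OF yT(2)] z(2) by simp
  then have "b \<le> norm a"
    using surjectivity_index_bound_closure[OF bound yT(3)] yT(1) by simp
  then show False using a(2) c(2) by simp
qed

text \<open>
  Since \<open>dist (f x0) y < \<delta> * b\<close>, there is room for both a slope \<open>c < b\<close> and a radius \<open>r < \<delta>\<close> with
  \<open>dist (f x0) y < r * c\<close>.  The gap in the radius provides a complete domain for Ekeland's principle and
  keeps the resulting point off its boundary, so that all directions are admissible there; the
  gap in the slope yields the contradiction.
\<close>

lemma chain_rule_ball_subset_image: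
  fixes f :: "'a::banach \<Rightarrow> 'b::real_normed_vector"
  assumes cont: "continuous_on U f" and chain: "chain_rule_condition U f Jf"
    and bound: "\<And>T x. x \<in> U \<Longrightarrow> T \<in> convex hull (Jf x) \<Longrightarrow> ereal b \<le> surjectivity_index T"
    and ball: "ball x0 \<delta> \<subseteq> U" and \<delta>: "\<delta> > 0" and b: "b > 0"
  shows "ball (f x0) (\<delta> * b) \<subseteq> f ` ball x0 \<delta>"
proof
  fix y assume "y \<in> ball (f x0) (\<delta> * b)"
  then have y: "norm (f x0 - y) < \<delta> * b" by (simp add: dist_norm)
  show "y \<in> f ` ball x0 \<delta>"
  proof (rule ccontr)
    assume out: "y \<notin> f ` ball x0 \<delta>"
    define \<phi> where "\<phi> x = norm (f x - y)" for x
    have "\<phi> x0 / \<delta> < b" using y \<delta> by (simp add: \<phi>_def field_simps)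
    then obtain c where c: "\<phi> x0 / \<delta> < c" "c < b" using dense by blast
    have c0: "c > 0" using c(1) \<delta> by (smt (verit) \<phi>_def divide_nonneg_pos norm_ge_zero)
    have "\<phi> x0 / c < \<delta>" using c(1) c0 \<delta> by (simp add: field_simps)
    then obtain r where r: "\<phi> x0 / c < r" "r < \<delta>" using dense by blast
    have r0: "r > 0" using r(1) c0 by (smt (verit) \<phi>_def divide_nonneg_pos norm_ge_zero)
    have sub: "cball x0 r \<subseteq> ball x0 \<delta>" using r(2) by auto
    have "continuous_on (cball x0 r) \<phi>"
      unfolding \<phi>_def using sub ball
      by (intro continuous_intros continuous_on_subset[OF cont]) auto
    moreover have "bdd_below (\<phi> ` cball x0 r)"
      by (intro bdd_belowI2[of _ 0]) (simp add: \<phi>_def)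
    moreover have "complete (cball x0 r)" by (simp add: complete_eq_closed)
    moreover have "x0 \<in> cball x0 r" using r0 by simp
    ultimately obtain z where z: "z \<in> cball x0 r" "\<phi> z + c * dist z x0 \<le> \<phi> x0"
        "\<And>x. x \<in> cball x0 r \<Longrightarrow> x \<noteq> z \<Longrightarrow> \<phi> z < \<phi> x + c * dist x z"
      using ekeland_variational_principle[OF _ _ _ _ c0] by metis
    have "c * dist z x0 < c * r"
      using z(2) r(1) c0 by (smt (verit) \<phi>_def mult.commute norm_ge_zero pos_divide_less_eq)
    then have zin: "z \<in> ball x0 r" using c0 by (simp add: dist_commute)
    have "\<forall>\<^sub>F x in at z. x \<in> ball x0 r"
      using zin by (intro eventually_at_in_open') auto
    then have "\<forall>\<^sub>F x in at z. norm (f z - y) \<le> norm (f x - y) + c * dist x z"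
    proof eventually_elim
      case (elim x)
      then show ?case using z(3)[of x] by (cases "x = z") (auto simp: \<phi>_def)
    qed
    moreover have "z \<in> ball x0 \<delta>" using z(1) sub by blast
    then have "z \<in> U" "y \<noteq> f z" using ball out by blast+
    ultimately show False
      using chain_rule_no_almost_minimizer[OF chain _ _ _ _ c(2) bound] c0 by auto
  qed
qed

theorem theorem3p1:
  fixes U :: "'a::banach set"
    and f :: "'a \<Rightarrow> 'b::banach"
    and Jf :: "'a \<Rightarrow> ('a \<Rightarrow>\<^sub>L 'b) set"
    and \<alpha> :: ereal
  assumes "open U"
    and "continuous_on U f"
    and "pseudo_Jacobian_mapping U f Jf"
    and "chain_rule_condition U f Jf"
    and "\<alpha> = Inf {surjectivity_index T | T x. T \<in> convex hull (Jf x) \<and> x \<in> U}"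
    and "\<alpha> > 0"
  shows "(\<forall>x\<^sub>0 \<delta>. \<delta> > 0 \<and> ball x\<^sub>0 \<delta> \<subseteq> U \<longrightarrow>
            {y. ereal (dist (f x\<^sub>0) y) < ereal \<delta> * \<alpha>} \<subseteq> f ` ball x\<^sub>0 \<delta>) \<and>
         open (f ` U) \<and>
         open_map (top_of_set U) (top_of_set (f ` U)) f"
proof -
  have covers: "ball (f x) (\<delta> * b) \<subseteq> f ` ball x \<delta>"
    if "ball x \<delta> \<subseteq> U" "\<delta> > 0" "b > 0" "ereal b \<le> \<alpha>" for x \<delta> b
  proof (rule chain_rule_ball_subset_image[OF assms(2,4) _ that(1-3)])
    fix T x assume "x \<in> U" "T \<in> convex hull (Jf x)"
    then have "\<alpha> \<le> surjectivity_index T"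
      unfolding assms(5) by (intro Inf_lower) blast
    then show "ereal b \<le> surjectivity_index T" using that(4) by simp
  qed
  have quantitative: "{y. ereal (dist (f x) y) < ereal \<delta> * \<alpha>} \<subseteq> f ` ball x \<delta>"
    if \<delta>: "\<delta> > 0" "ball x \<delta> \<subseteq> U" for x \<delta>
  proof safe
    fix y assume y: "ereal (dist (f x) y) < ereal \<delta> * \<alpha>"
    \<comment> \<open>\<open>\<alpha>\<close> is infinite when \<open>U\<close> is empty or the target space is trivial\<close>
    have "ereal (dist (f x) y / \<delta>) < \<alpha>"
    proof (cases \<alpha>)
      case (real a)
      then show ?thesis using y \<delta> by (simp add: field_simps)
    qed (use assms(6) in auto)
    then obtain b where b: "ereal (dist (f x) y / \<delta>) < ereal b" "ereal b < \<alpha>"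
      using ereal_dense2 by blast
    then have "dist (f x) y < \<delta> * b" using \<delta> by (simp add: field_simps)
    then have "y \<in> ball (f x) (\<delta> * b)" by simp
    moreover have "b > 0"
      using b(1) \<delta> by (smt (verit) divide_nonneg_pos less_ereal.simps(1) zero_le_dist)
    ultimately show "y \<in> f ` ball x \<delta>"
      using covers[OF \<delta>(2,1), of b] b(2) by (blast intro: less_imp_le)
  qed
  obtain b where b: "0 < ereal b" "ereal b < \<alpha>"
    using ereal_dense2[OF assms(6)] by blast
  have image_open: "open (f ` W)" if "open W" "W \<subseteq> U" for W
    unfolding open_contains_ball
  proof safe
    fix x assume "x \<in> W"
    then obtain \<delta> where \<delta>: "\<delta> > 0" "ball x \<delta> \<subseteq> W"
      using \<open>open W\<close> by (meson openE)
    then have "ball (f x) (\<delta> * b) \<subseteq> f ` W"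
      using covers[of x \<delta> b] that(2) b by fastforce
    then show "\<exists>e>0. ball (f x) e \<subseteq> f ` W"
      using \<delta>(1) b(1) by (intro exI[of _ "\<delta> * b"]) simp
  qed
  have "open_map (top_of_set U) (top_of_set (f ` U)) f"
    unfolding open_map_def
  proof safe
    fix W assume "openin (top_of_set U) W"
    then have "open W" "W \<subseteq> U"
      using assms(1) by (auto simp: openin_open_eq)
    then show "openin (top_of_set (f ` U)) (f ` W)"
      by (intro open_subset image_open) auto
  qed
  then show ?thesis
    using quantitative image_open[OF assms(1)] by blast
qed

end
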